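(* Let $k\geq 3$ and $m\geq 4$ be integers with $k\leq m-1$. Then for every positive integer $n$, $$\mathrm{sat}_k(n,\text{Berge-}K_{1,m})\leq \left\lceil\frac{n}{m}\right\rceil\binom{m}{k}.$$
   Context: Hypergraphs are finite and have no repeated edges; a hypergraph is $k$-uniform if every edge has exactly $k$ vertices. $K_{1,m}$ is the star graph with $m$ edges. For a graph $F$, a hypergraph $B$ is a Berge-$F$ if (with $V(F)$ identified with distinct vertices of $B$) there is a bijection $\phi:E(F)\to E(B)$ with $e\subseteq\phi(e)$ for all $e\in E(F)$. A hypergraph contains a Berge-$F$ if some subhypergraph of it is a Berge-$F$. A $k$-uniform hypergraph $H$ is Berge-$F$-saturated if $H$ contains no Berge-$F$, but for every $k$-subset $e$ of $V(H)$ with $e\notin E(H)$ the hypergraph $H+e$ contains a Berge-$F$. $\mathrm{sat}_k(n,\text{Berge-}F)$ is the minimum number of edges of a $k$-uniform Berge-$F$-saturated hypergraph on $n$ vertices. *)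

theory Defs
  imports Complex_Main
begin

text \<open>
  A hypergraph is a pair of a vertex set and an edge set; representing the edges as a set of
  vertex sets excludes repeated edges.  A graph is a 2-uniform hypergraph.
\<close>

type_synonym 'a hypergraph = "'a set \<times> 'a set set"

abbreviation verts :: "'a hypergraph \<Rightarrow> 'a set" where
  "verts H \<equiv> fst H"

abbreviation edges :: "'a hypergraph \<Rightarrow> 'a set set" where
  "edges H \<equiv> snd H"

definition hypergraph :: "'a hypergraph \<Rightarrow> bool" where
  "hypergraph H \<longleftrightarrow> finite (verts H) \<and> (\<forall>e\<in>edges H. e \<subseteq> verts H)"

definition uniform :: "nat \<Rightarrow> 'a hypergraph \<Rightarrow> bool" where
  "uniform k H \<longleftrightarrow> (\<forall>e\<in>edges H. card e = k)"

definition subhypergraph :: "'a hypergraph \<Rightarrow> 'a hypergraph \<Rightarrow> bool" where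
  "subhypergraph B H \<longleftrightarrow> hypergraph B \<and> verts B \<subseteq> verts H \<and> edges B \<subseteq> edges H"

definition add_edge :: "'a hypergraph \<Rightarrow> 'a set \<Rightarrow> 'a hypergraph" where
  "add_edge H e = (verts H, insert e (edges H))"

text \<open>The injection \<open>f\<close> identifies the vertices of \<open>F\<close> with distinct vertices of \<open>B\<close>.\<close>

definition is_Berge :: "'b hypergraph \<Rightarrow> 'a hypergraph \<Rightarrow> bool" where
  "is_Berge F B \<longleftrightarrow>
     (\<exists>f \<phi>. inj_on f (verts F) \<and> f ` verts F \<subseteq> verts B \<and>
            bij_betw \<phi> (edges F) (edges B) \<and> (\<forall>e\<in>edges F. f ` e \<subseteq> \<phi> e))"

definition contains_Berge :: "'b hypergraph \<Rightarrow> 'a hypergraph \<Rightarrow> bool" where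
  "contains_Berge F H \<longleftrightarrow> (\<exists>B. subhypergraph B H \<and> is_Berge F B)"

definition Berge_saturated :: "nat \<Rightarrow> 'b hypergraph \<Rightarrow> 'a hypergraph \<Rightarrow> bool" where
  "Berge_saturated k F H \<longleftrightarrow>
     hypergraph H \<and> uniform k H \<and> \<not> contains_Berge F H \<and>
     (\<forall>e. e \<subseteq> verts H \<and> card e = k \<and> e \<notin> edges H \<longrightarrow> contains_Berge F (add_edge H e))"

text \<open>
  Saturation is invariant under relabelling vertices, so vertices are taken to be natural numbers
  without loss of generality.  A saturated hypergraph, and hence the minimum, exists as soon as
  \<open>F\<close> has an edge.
\<close>

definition sat_Berge :: "nat \<Rightarrow> nat \<Rightarrow> 'b hypergraph \<Rightarrow> nat" where
  "sat_Berge k n F =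
     (LEAST c. \<exists>H :: nat hypergraph. card (verts H) = n \<and> Berge_saturated k F H \<and>
                                     card (edges H) = c)"

text \<open>The star with centre \<open>0\<close> and leaves \<open>1, \<dots>, m\<close>.\<close>

definition star :: "nat \<Rightarrow> nat hypergraph" where
  "star m = ({0..m}, {{0, i} | i. i \<in> {1..m}})"

end

theory Submission imports Defs begin

text \<open>
  Partition the \<open>n\<close> vertices into consecutive blocks of \<open>m\<close> vertices, the last of which may be
  smaller, and take as edges all \<open>k\<close>-sets that lie inside one block.  There are
  \<open>\<lceil>n / m\<rceil>\<close> blocks with at most \<open>m choose k\<close> edges each, so it suffices that this hypergraph is
  saturated.

  A Berge star with \<open>m\<close> leaves needs a centre that shares edges with \<open>m\<close> other vertices, but a
  vertex only shares edges with the at most \<open>m - 1\<close> other vertices of its block.  Conversely, a new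
  \<open>k\<close>-set \<open>e\<close> meets two blocks, and the first block that it meets is full, because only the
  last block can be smaller.  Centre a star at a vertex \<open>u\<close> of \<open>e\<close> in that full block: the edge \<open>e\<close>
  reaches a vertex outside the block, and the other \<open>m - 1\<close> vertices of the block are reached by
  distinct edges inside the block.  Once \<open>u\<close> is removed from them, these edges have to be
  distinct \<open>(k - 1)\<close>-subsets of an \<open>(m - 1)\<close>-set, one through each element.  The cyclic intervals of length \<open>k - 1\<close> do this since \<open>0 < k - 1 < m - 1\<close>; this is
  where \<open>k \<le> m - 1\<close> enters.
\<close>

section \<open>Distinct subsets of prescribed size through each element\<close>

text \<open>The cyclic interval of length \<open>s\<close> in \<open>{..<p}\<close> that starts at \<open>i\<close>, for \<open>i < p\<close> and \<open>s \<le> p\<close>;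
  the second disjunct describes the part that wraps around.\<close>

definition cyclic_interval :: "nat \<Rightarrow> nat \<Rightarrow> nat \<Rightarrow> nat set" where
  "cyclic_interval p s i = {y. y < p \<and> (i \<le> y \<and> y < i + s \<or> y + p < i + s)}"

lemma card_cyclic_interval:
  assumes "i < p" and "s \<le> p"
  shows "card (cyclic_interval p s i) = s"
proof -
  have "cyclic_interval p s i = {i..<min p (i + s)} \<union> {0..<i + s - p}"
    using assms by (auto simp: cyclic_interval_def)
  moreover have "card ({i..<min p (i + s)} \<union> {0..<i + s - p})
      = card {i..<min p (i + s)} + card {0..<i + s - p}"
    using assms by (intro card_Un_disjoint) auto
  ultimately show ?thesis using assms by (simp add: min_def split: if_splits)
qed

text \<open>A proper cyclic interval determines its starting point: it is the only element of the interval
  whose cyclic predecessor is missing.\<close>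

lemma cyclic_interval_start_unique:
  assumes "i < j" and "j < p" and "0 < s" and "s < p"
  shows "cyclic_interval p s i \<noteq> cyclic_interval p s j"
proof
  assume eq: "cyclic_interval p s i = cyclic_interval p s j"
  have "i \<in> cyclic_interval p s i"
    using assms by (simp add: cyclic_interval_def)
  then have wrap: "i + p < j + s"
    unfolding eq using assms by (simp add: cyclic_interval_def)
  \<comment> \<open>the interval from \<open>j\<close> wraps around beyond \<open>i\<close>, so it contains the predecessor of \<open>i\<close>\<close>
  define y where "y = (if i = 0 then p - 1 else i - 1)"
  have "y \<in> cyclic_interval p s j"
    using assms wrap by (auto simp: cyclic_interval_def y_def)
  moreover have "y \<notin> cyclic_interval p s i"
    using assms by (auto simp: cyclic_interval_def y_def)
  ultimately show False using eq by simp
qed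

lemma ex_distinct_subsets_through_elements:
  assumes "finite A" and "0 < s" and "s < card A"
  obtains g where "inj_on g A" and "\<And>x. x \<in> A \<Longrightarrow> x \<in> g x \<and> g x \<subseteq> A \<and> card (g x) = s"
proof -
  let ?p = "card A"
  obtain h where h: "bij_betw h A {0..<?p}"
    using ex_bij_betw_finite_nat[OF assms(1)] by blast
  define h' where "h' = the_inv_into A h"
  have h': "bij_betw h' {0..<?p} A"
    unfolding h'_def by (rule bij_betw_the_inv_into[OF h])
  have h'h: "h' (h x) = x" if "x \<in> A" for x
    using h that by (simp add: h'_def bij_betw_def the_inv_into_f_f)
  have hlt: "h x < ?p" if "x \<in> A" for x
    using h that by (auto simp: bij_betw_def)
  define C where "C i = cyclic_interval ?p s i" for i
  have C_sub: "C i \<subseteq> {0..<?p}" for i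
    by (auto simp: C_def cyclic_interval_def)
  have inj_h': "inj_on h' {0..<?p}" using h' by (simp add: bij_betw_def)
  show ?thesis
  proof (rule that[of "\<lambda>x. h' ` C (h x)"])
    show "inj_on (\<lambda>x. h' ` C (h x)) A"
    proof (rule inj_onI)
      fix x y assume xy: "x \<in> A" "y \<in> A" and eq: "h' ` C (h x) = h' ` C (h y)"
      have "C (h x) = C (h y)"
        using eq inj_on_image_eq_iff[OF inj_h' C_sub C_sub] by simp
      then have "h x = h y"
        using cyclic_interval_start_unique[of "h x" "h y" ?p s]
          cyclic_interval_start_unique[of "h y" "h x" ?p s] hlt xy assms
        unfolding C_def by (metis linorder_neqE_nat)
      then show "x = y" using h'h xy by metis
    qed
  next
    fix x assume x: "x \<in> A"
    have "h x \<in> C (h x)"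
      using hlt[OF x] assms by (simp add: C_def cyclic_interval_def)
    then have "x \<in> h' ` C (h x)" using h'h[OF x] by force
    moreover have "h' ` C (h x) \<subseteq> A"
      using C_sub h' by (auto simp: bij_betw_def)
    moreover have "card (h' ` C (h x)) = s"
      using card_image[OF inj_on_subset[OF inj_h' C_sub]]
        card_cyclic_interval[OF hlt[OF x]] assms by (simp add: C_def)
    ultimately show "x \<in> h' ` C (h x) \<and> h' ` C (h x) \<subseteq> A \<and> card (h' ` C (h x)) = s"
      by blast
  qed
qed

section \<open>Berge stars\<close>

text \<open>The two directions below replace the bijection between edge sets by data at the centre: a set of
  \<open>m\<close> leaves, and distinct edges that join them to the centre.\<close>

lemma contains_Berge_star_imp_neighbours:
  assumes "contains_Berge (star m) H"
  obtains c L where "card L = m" and "c \<notin> L" and "\<And>x. x \<in> L \<Longrightarrow> \<exists>e\<in>edges H. c \<in> e \<and> x \<in> e"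
proof -
  obtain B f \<phi> where B: "edges B \<subseteq> edges H"
    and f: "inj_on f {0..m}"
    and \<phi>: "bij_betw \<phi> (edges (star m)) (edges B)"
    and sub: "\<And>e. e \<in> edges (star m) \<Longrightarrow> f ` e \<subseteq> \<phi> e"
    using assms by (auto simp: contains_Berge_def subhypergraph_def is_Berge_def star_def)
  show ?thesis
  proof (rule that[of "f ` {1..m}" "f 0"])
    show "card (f ` {1..m}) = m"
      using card_image[OF inj_on_subset[OF f, of "{1..m}"]] by auto
    show "f 0 \<notin> f ` {1..m}"
      using f by (auto dest: inj_onD)
  next
    fix x assume "x \<in> f ` {1..m}"
    then obtain i where i: "i \<in> {1..m}" "x = f i" by blast
    then have edge: "{0, i} \<in> edges (star m)" by (auto simp: star_def)
    have "\<phi> {0, i} \<in> edges H"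
      using edge \<phi> B by (auto simp: bij_betw_def)
    with sub[OF edge] i show "\<exists>e\<in>edges H. f 0 \<in> e \<and> x \<in> e" by auto
  qed
qed

lemma contains_Berge_starI:
  assumes "hypergraph H" and "c \<in> verts H" and "L \<subseteq> verts H" and "c \<notin> L" and "card L = m"
    and g: "inj_on g L" "\<And>x. x \<in> L \<Longrightarrow> g x \<in> edges H \<and> c \<in> g x \<and> x \<in> g x"
  shows "contains_Berge (star m) H"
proof -
  have "finite L"
    using assms finite_subset by (auto simp: hypergraph_def)
  then obtain h where h: "bij_betw h {1..m} L"
    using assms(5) ex_bij_betw_nat_finite_1 by blast
  define f where "f i = (if i = 0 then c else h i)" for i
  \<comment> \<open>the leaf of the edge \<open>{0, i}\<close> of the star is recovered as its maximum\<close>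
  define \<phi> where "\<phi> e = g (h (Max e))" for e
  define B where "B = (verts H, g ` L)"
  have hL: "h i \<in> L" if "i \<in> {1..m}" for i
    using h that by (auto simp: bij_betw_def)
  have inj_h: "inj_on h {1..m}" and img_h: "h ` {1..m} = L"
    using h by (auto simp: bij_betw_def)
  have star_edges: "edges (star m) = (\<lambda>i. {0, i}) ` {1..m}"
    by (auto simp: star_def)
  have "subhypergraph B H"
    using assms by (auto simp: subhypergraph_def B_def hypergraph_def)
  moreover have "inj_on f (verts (star m))"
  proof (rule inj_onI)
    fix i j assume ij: "i \<in> verts (star m)" "j \<in> verts (star m)" "f i = f j"
    then have "i = 0 \<or> i \<in> {1..m}" "j = 0 \<or> j \<in> {1..m}" by (auto simp: star_def)
    then show "i = j"
      using ij(3) hL assms(4) inj_onD[OF inj_h] by (auto simp: f_def split: if_splits)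
  qed
  moreover have "f ` verts (star m) \<subseteq> verts B"
    using hL assms(2,3) by (force simp: f_def B_def star_def)
  moreover have "bij_betw \<phi> (edges (star m)) (edges B)"
  proof (rule bij_betw_imageI)
    have \<phi>: "\<phi> {0, i} = g (h i)" for i by (simp add: \<phi>_def)
    show "inj_on \<phi> (edges (star m))"
    proof (rule inj_onI)
      fix d e assume "d \<in> edges (star m)" "e \<in> edges (star m)" and eq: "\<phi> d = \<phi> e"
      then obtain i j where ij: "i \<in> {1..m}" "j \<in> {1..m}" "d = {0, i}" "e = {0, j}"
        by (auto simp: star_edges)
      then have "h i = h j" using eq \<phi> hL inj_onD[OF g(1)] by simp
      then show "d = e" using ij inj_onD[OF inj_h] by blast
    qed
    show "\<phi> ` edges (star m) = edges B"
      unfolding star_edges image_image \<phi> B_def img_h[symmetric] by simp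
  qed
  moreover have "\<forall>e\<in>edges (star m). f ` e \<subseteq> \<phi> e"
    using g(2) hL by (auto simp: star_edges f_def \<phi>_def)
  ultimately show ?thesis
    unfolding contains_Berge_def is_Berge_def by blast
qed

section \<open>The block hypergraph\<close>

text \<open>The blocks are the classes of vertices with the same quotient by \<open>m\<close>, so all blocks but the last
  have exactly \<open>m\<close> vertices.\<close>

definition block_hypergraph :: "nat \<Rightarrow> nat \<Rightarrow> nat \<Rightarrow> nat hypergraph" where
  "block_hypergraph n m k =
     ({..<n}, {e. e \<subseteq> {..<n} \<and> card e = k \<and> (\<exists>q. \<forall>v\<in>e. v div m = q)})"

lemma block_hypergraph_edgeD:
  assumes "e \<in> edges (block_hypergraph n m k)"
  shows "e \<subseteq> {..<n}" and "card e = k" and "u \<in> e \<Longrightarrow> v \<in> e \<Longrightarrow> u div m = v div m"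
proof -
  have e: "e \<subseteq> {..<n} \<and> card e = k \<and> (\<exists>q. \<forall>w\<in>e. w div m = q)"
    using assms unfolding block_hypergraph_def snd_conv mem_Collect_eq .
  show "e \<subseteq> {..<n}" by (rule conjunct1[OF e])
  show "card e = k" by (rule conjunct1[OF conjunct2[OF e]])
  obtain q where q: "\<forall>w\<in>e. w div m = q"
    using conjunct2[OF conjunct2[OF e]] by (rule exE)
  show "u div m = v div m" if "u \<in> e" "v \<in> e"
    using bspec[OF q that(1)] bspec[OF q that(2)] by (rule trans[OF _ sym])
qed

lemma block_eq_interval:
  fixes m q :: nat
  assumes "0 < m"
  shows "{x. x div m = q} = {q * m..<q * m + m}"
proof (intro set_eqI iffI)
  fix x assume "x \<in> {x. x div m = q}"
  then have "x = q * m + x mod m" using div_mult_mod_eq[of x m] by simp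
  moreover have "x mod m < m" using assms by simp
  ultimately show "x \<in> {q * m..<q * m + m}"
    unfolding atLeastLessThan_iff by linarith
next
  fix x assume "x \<in> {q * m..<q * m + m}"
  then show "x \<in> {x. x div m = q}"
    using div_nat_eqI[of m q x] by (simp add: mult.commute)
qed

text \<open>The neighbours of a vertex lie in its own block, which leaves at most \<open>m - 1\<close> candidates for
  the leaves.\<close>

lemma block_hypergraph_no_Berge_star:
  assumes "0 < m"
  shows "\<not> contains_Berge (star m) (block_hypergraph n m k)"
proof
  assume "contains_Berge (star m) (block_hypergraph n m k)"
  then obtain c L where L: "card L = m" "c \<notin> L"
    and nb: "\<And>x. x \<in> L \<Longrightarrow> \<exists>e\<in>edges (block_hypergraph n m k). c \<in> e \<and> x \<in> e"
    using contains_Berge_star_imp_neighbours by blast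
  let ?Q = "{(c div m) * m..<(c div m) * m + m}"
  have "x div m = c div m" if x: "x \<in> L" for x
  proof -
    obtain e where e: "e \<in> edges (block_hypergraph n m k)" "c \<in> e" "x \<in> e"
      using nb[OF x] by blast
    show ?thesis by (rule block_hypergraph_edgeD(3)[OF e(1) e(3) e(2)])
  qed
  then have "L \<subseteq> {x. x div m = c div m} - {c}" using L(2) by blast
  then have sub: "L \<subseteq> ?Q - {c}" unfolding block_eq_interval[OF assms] .
  have "c \<in> {x. x div m = c div m}" by simp
  then have "c \<in> ?Q" unfolding block_eq_interval[OF assms] .
  then have "card (?Q - {c}) = m - 1" by simp
  with sub have "card L \<le> m - 1" by (metis card_mono finite_Diff finite_atLeastLessThan)
  with L(1) assms show False by simp
qed

text \<open>A missing \<open>k\<close>-set \<open>e\<close> completes a star centred at a vertex of \<open>e\<close> whose block is full: that block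
  alone yields \<open>m - 1\<close> leaves, and \<open>e\<close> itself joins the centre to one leaf in another block.\<close>

lemma block_hypergraph_saturated:
  assumes "2 \<le> k" and "k < m"
  shows "Berge_saturated k (star m) (block_hypergraph n m k)"
  unfolding Berge_saturated_def
proof (intro conjI allI impI)
  let ?H = "block_hypergraph n m k"
  have verts: "verts ?H = {..<n}" by (simp add: block_hypergraph_def)
  show hyp: "hypergraph ?H"
    unfolding hypergraph_def verts using block_hypergraph_edgeD(1) by blast
  show "uniform k ?H"
    unfolding uniform_def using block_hypergraph_edgeD(2) by blast
  show "\<not> contains_Berge (star m) ?H"
    using assms by (intro block_hypergraph_no_Berge_star) simp
  have m: "0 < m" using assms by simp
  fix e assume e: "e \<subseteq> verts ?H \<and> card e = k \<and> e \<notin> edges ?H"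
  then have "\<not> (\<exists>q. \<forall>v\<in>e. v div m = q)"
    by (simp add: verts block_hypergraph_def)
  then have differ: "\<exists>v\<in>e. v div m \<noteq> q" for q by blast
  then obtain a where a: "a \<in> e" by blast
  obtain b where b: "b \<in> e" "b div m \<noteq> a div m" using bexE[OF differ] .
  obtain u v where uv: "u \<in> e" "v \<in> e" "u div m < v div m"
  proof (cases "a div m < b div m")
    case True
    then show ?thesis by (rule that[OF a b(1)])
  next
    case False
    then have "b div m < a div m" using b(2) by simp
    then show ?thesis by (rule that[OF b(1) a])
  qed
  have vn: "v < n" using e uv by (auto simp: verts)
  define Q where "Q = {x. x div m = u div m}"
  have Q_eq: "Q = {(u div m) * m..<(u div m) * m + m}"
    unfolding Q_def by (rule block_eq_interval[OF m])
  have "card Q = m" "finite Q" by (simp_all add: Q_eq)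
  have uQ: "u \<in> Q" and vQ: "v \<notin> Q" using uv by (auto simp: Q_def)
  \<comment> \<open>the block of \<open>u\<close> is full, since \<open>v\<close> is a vertex of a later block\<close>
  have Qn: "Q \<subseteq> {..<n}"
  proof
    fix x assume "x \<in> Q"
    then have "x div m < v div m" using uv by (simp add: Q_def)
    then have "x < v" using div_le_mono[of v x m] by linarith
    then show "x \<in> {..<n}" using vn by simp
  qed
  have cardA: "card (Q - {u}) = m - 1" using uQ \<open>card Q = m\<close> \<open>finite Q\<close> by simp
  obtain g where g: "inj_on g (Q - {u})"
    and gx: "\<And>x. x \<in> Q - {u} \<Longrightarrow> x \<in> g x \<and> g x \<subseteq> Q - {u} \<and> card (g x) = k - 1"
  proof (rule ex_distinct_subsets_through_elements[of "Q - {u}" "k - 1"])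
    show "finite (Q - {u})" "0 < k - 1" "k - 1 < card (Q - {u})"
      using assms cardA \<open>finite Q\<close> by auto
  qed blast
  define g' where "g' x = (if x = v then e else insert u (g x))" for x
  let ?L = "insert v (Q - {u})"
  have g'Q: "g' x \<in> edges ?H \<and> u \<in> g' x \<and> x \<in> g' x \<and> v \<notin> g' x" if x: "x \<in> Q - {u}" for x
  proof -
    have sub: "insert u (g x) \<subseteq> Q" using gx[OF x] uQ by auto
    have "finite (g x)" using gx[OF x] \<open>finite Q\<close> finite_subset by blast
    then have "card (insert u (g x)) = k" using gx[OF x] assms by (simp add: subset_Diff_insert)
    moreover have "\<exists>q. \<forall>w\<in>insert u (g x). w div m = q"
      using sub unfolding Q_def by (intro exI[of _ "u div m"]) blast
    moreover have "insert u (g x) \<subseteq> {..<n}" using sub Qn by blast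
    ultimately have "insert u (g x) \<in> edges ?H"
      unfolding block_hypergraph_def by simp
    moreover have "g' x = insert u (g x)" using x vQ by (auto simp: g'_def)
    ultimately show ?thesis using gx[OF x] sub vQ by auto
  qed
  show "contains_Berge (star m) (add_edge ?H e)"
  proof (rule contains_Berge_starI[where c = u and L = ?L and g = g'])
    show "hypergraph (add_edge ?H e)"
      using e hyp by (simp add: add_edge_def hypergraph_def)
    show "u \<in> verts (add_edge ?H e)" "?L \<subseteq> verts (add_edge ?H e)"
      using uQ Qn vn by (auto simp: verts add_edge_def)
    show "u \<notin> ?L" using uv by auto
    show "card ?L = m" using cardA vQ \<open>finite Q\<close> m by simp
    show "inj_on g' ?L"
    proof (rule inj_onI)
      fix x y assume xy: "x \<in> ?L" "y \<in> ?L" "g' x = g' y"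
      have "g' v = e" by (simp add: g'_def)
      show "x = y"
      proof (cases "x = v \<or> y = v")
        case True
        then show ?thesis using xy g'Q \<open>g' v = e\<close> uv(2) by auto
      next
        case False
        then have Q: "x \<in> Q - {u}" "y \<in> Q - {u}" using xy by auto
        then have "insert u (g x) = insert u (g y)"
          using xy(3) False by (simp add: g'_def)
        moreover have "u \<notin> g x" "u \<notin> g y" using gx Q by blast+
        ultimately have "g x = g y" by (simp add: insert_ident)
        then show ?thesis using Q inj_onD[OF g] by blast
      qed
    qed
    fix x assume "x \<in> ?L"
    then show "g' x \<in> edges (add_edge ?H e) \<and> u \<in> g' x \<and> x \<in> g' x"
    proof (cases "x = v")
      case True
      then show ?thesis using uv by (simp add: add_edge_def g'_def)
    next
      case False
      then have "x \<in> Q - {u}" using \<open>x \<in> ?L\<close> by blast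
      from g'Q[OF this] show ?thesis by (simp add: add_edge_def)
    qed
  qed
qed

text \<open>Completing the last block to \<open>m\<close> vertices can only create more edges, so every block may be
  counted as full.\<close>

lemma card_edges_block_hypergraph:
  assumes "0 < m" and "0 < k" and "n \<le> N * m"
  shows "card (edges (block_hypergraph n m k)) \<le> N * (m choose k)"
proof -
  define S where "S q = {e. e \<subseteq> {q * m..<q * m + m} \<and> card e = k}" for q
  have "edges (block_hypergraph n m k) \<subseteq> (\<Union>q<N. S q)"
  proof
    fix e assume e: "e \<in> edges (block_hypergraph n m k)"
    then have "e \<noteq> {}" using assms block_hypergraph_edgeD(2) by fastforce
    then obtain u where u: "u \<in> e" by blast
    then have "u < N * m" using block_hypergraph_edgeD(1)[OF e] assms by auto
    then have "u div m < N" by (rule less_mult_imp_div_less)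
    moreover have "e \<subseteq> {x. x div m = u div m}"
      using block_hypergraph_edgeD(3)[OF e _ u] by blast
    moreover have "card e = k" by (rule block_hypergraph_edgeD(2)[OF e])
    ultimately show "e \<in> (\<Union>q<N. S q)"
      unfolding block_eq_interval[OF assms(1)] S_def by blast
  qed
  moreover have "finite (S q)" for q unfolding S_def by simp
  ultimately have "card (edges (block_hypergraph n m k)) \<le> card (\<Union>q<N. S q)"
    by (intro card_mono) auto
  also have "\<dots> \<le> (\<Sum>q<N. card (S q))" by (rule card_UN_le) simp
  also have "\<dots> = N * (m choose k)" by (simp add: S_def n_subsets)
  finally show ?thesis .
qed

theorem theorem5p9:
  fixes k m n :: nat
  assumes "k \<ge> 3" and "m \<ge> 4" and "k \<le> m - 1" and "n \<ge> 1"
  shows "int (sat_Berge k n (star m)) \<le> \<lceil>real n / real m\<rceil> * int (m choose k)"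
proof -
  let ?H = "block_hypergraph n m k"
  define N where "N = nat \<lceil>real n / real m\<rceil>"
  have "0 \<le> real n / real m" by simp
  then have "0 \<le> \<lceil>real n / real m\<rceil>" by linarith
  then have N: "int N = \<lceil>real n / real m\<rceil>" unfolding N_def by simp
  then have "real n / real m \<le> real N" by linarith
  then have "real n \<le> real (N * m)" using assms by (simp add: field_simps)
  then have "n \<le> N * m" by linarith
  have "Berge_saturated k (star m) ?H"
    using assms by (intro block_hypergraph_saturated) auto
  moreover have "card (verts ?H) = n" by (simp add: block_hypergraph_def)
  ultimately have "sat_Berge k n (star m) \<le> card (edges ?H)"
    unfolding sat_Berge_def by (intro Least_le) blast
  also have "\<dots> \<le> N * (m choose k)"
    using assms \<open>n \<le> N * m\<close> by (intro card_edges_block_hypergraph) auto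
  finally have "int (sat_Berge k n (star m)) \<le> int N * int (m choose k)"
    by (metis of_nat_le_iff of_nat_mult)
  then show ?thesis using N by simp
qed

end
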